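(* The class of graded neighbourhood frames is not modally definable; that is, there is no set $\Delta$ of $\mathcal{L}_g$-formulas such that for every neighbourhood frame $\mathbb{F}$: $\mathbb{F}\Vdash\Delta$ if and only if $\mathbb{F}$ is a graded neighbourhood frame.
   Context: $\mathbb{N}$ includes $0$. Let $\mathsf{Prop}$ be a set of proposition letters. The language $\mathcal{L}_g$ is given by $\varphi::=p\mid\neg\varphi\mid(\varphi\lor\varphi)\mid\Diamond_n\varphi$ with $p\in\mathsf{Prop}$, $n\in\mathbb{N}$; other connectives, including $\bot$ and $\top$, are defined as usual. A neighbourhood frame is a tuple $\mathbb{F}=(W,\{\nu_n\}_{n\in\mathbb{N}})$ with $W$ a set and $\nu_n:W\to\mathcal{P}(\mathcal{P}(W))$ for each $n$. A neighbourhood model is $\mathbb{M}=(\mathbb{F},V)$ with $V:\mathsf{Prop}\to\mathcal{P}(W)$. Truth: $\mathbb{M},w\Vdash p$ iff $w\in V(p)$; $\neg,\lor$ are interpreted classically; $\mathbb{M},w\Vdash\Diamond_n\psi$ iff $\{v\in W:\mathbb{M},v\Vdash\psi\}\in\nu_n(w)$. $\mathbb{F}\Vdash\varphi$ means $(\mathbb{F},V),w\Vdash\varphi$ for all valuations $V$ and all $w\in W$; $\mathbb{F}\Vdash\Delta$ means $\mathbb{F}\Vdash\varphi$ for all $\varphi\in\Delta$. For a set $X$, $\mathcal{P}_{\ge n}(X)=\{X'\subseteq X:|X'|\ge n\}$. For $\Gamma\subseteq\mathcal{P}(W)$, $\uparrow\Gamma=\{Y\in\mathcal{P}(W):\exists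 X\in\Gamma,\ X\subseteq Y\}$. A neighbourhood frame is a graded neighbourhood frame if for all $w\in W$ there exists $A\subseteq W$ such that for all $n\in\mathbb{N}$, $\nu_n(w)=\uparrow\mathcal{P}_{\ge n}(A)$. *)

theory Defs
  imports Main
begin

text \<open>
  The set of proposition letters is the type \<^typ>\<open>'p\<close>.
\<close>

datatype 'p fm =
    Atom 'p
  | Neg "'p fm"
  | Or "'p fm" "'p fm"
  | Dia nat "'p fm"

record 'w nframe =
  worlds :: "'w set"
  nbhd :: "nat \<Rightarrow> 'w \<Rightarrow> 'w set set"

text \<open>
  Values of \<open>nbhd\<close> at points outside \<open>worlds\<close> are irrelevant to validity
  and gradedness. The set of worlds may be empty.
\<close>

definition neighbourhood_frame :: "'w nframe \<Rightarrow> bool" where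
  "neighbourhood_frame F \<longleftrightarrow> (\<forall>n. \<forall>w\<in>worlds F. nbhd F n w \<subseteq> Pow (worlds F))"

definition valuation :: "'w nframe \<Rightarrow> ('p \<Rightarrow> 'w set) \<Rightarrow> bool" where
  "valuation F V \<longleftrightarrow> (\<forall>p. V p \<subseteq> worlds F)"

primrec sat :: "'w nframe \<Rightarrow> ('p \<Rightarrow> 'w set) \<Rightarrow> 'w \<Rightarrow> 'p fm \<Rightarrow> bool" where
  "sat F V w (Atom p) \<longleftrightarrow> w \<in> V p"
| "sat F V w (Neg \<phi>) \<longleftrightarrow> \<not> sat F V w \<phi>"
| "sat F V w (Or \<phi> \<psi>) \<longleftrightarrow> sat F V w \<phi> \<or> sat F V w \<psi>"
| "sat F V w (Dia n \<phi>) \<longleftrightarrow> {v \<in> worlds F. sat F V v \<phi>} \<in> nbhd F n w"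

definition valid :: "'w nframe \<Rightarrow> 'p fm \<Rightarrow> bool" where
  "valid F \<phi> \<longleftrightarrow> (\<forall>V. valuation F V \<longrightarrow> (\<forall>w\<in>worlds F. sat F V w \<phi>))"

definition valid_set :: "'w nframe \<Rightarrow> 'p fm set \<Rightarrow> bool" where
  "valid_set F \<Delta> \<longleftrightarrow> (\<forall>\<phi>\<in>\<Delta>. valid F \<phi>)"

text \<open>
  Infinite subsets have at least \<open>n\<close> elements for every \<open>n\<close>; they are listed separately
  because \<^const>\<open>card\<close> is \<open>0\<close> on infinite sets.
\<close>

definition Pow_ge :: "nat \<Rightarrow> 'w set \<Rightarrow> 'w set set" where
  "Pow_ge n X = {X'. X' \<subseteq> X \<and> (infinite X' \<or> n \<le> card X')}"

definition upset :: "'w set \<Rightarrow> 'w set set \<Rightarrow> 'w set set" where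
  "upset W \<Gamma> = {Y \<in> Pow W. \<exists>X\<in>\<Gamma>. X \<subseteq> Y}"

definition graded_neighbourhood_frame :: "'w nframe \<Rightarrow> bool" where
  "graded_neighbourhood_frame F \<longleftrightarrow>
     neighbourhood_frame F \<and>
     (\<forall>w\<in>worlds F. \<exists>A\<subseteq>worlds F. \<forall>n. nbhd F n w = upset (worlds F) (Pow_ge n A))"

text \<open>
  Modal definability concerns frames on arbitrary sets, but a HOL proposition can only
  quantify over the frames whose worlds are drawn from one type \<^typ>\<open>'w\<close>. Undefinability relative to
  the frames over \<^typ>\<open>'w\<close> implies undefinability relative to all frames. It fails for
  some finite \<^typ>\<open>'w\<close>: over a one-element type, the class of graded frames is definable.
\<close>

definition defines_class :: "'p fm set \<Rightarrow> ('w nframe \<Rightarrow> bool) \<Rightarrow> bool" where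
  "defines_class \<Delta> K \<longleftrightarrow> (\<forall>F. neighbourhood_frame F \<longrightarrow> (valid_set F \<Delta> \<longleftrightarrow> K F))"

end

theory Submission
  imports Defs
begin

text \<open>
  Modally definable classes are closed under surjective bounded morphisms. The two-point frame
  in which every point has both points as its graded successors is graded, and it collapses onto
  a one-point frame. There the single point still satisfies \<open>\<Diamond>\<^sub>2 \<top>\<close>, although a set
  of successors inside a singleton has no subset of size two.
\<close>

text \<open>The equivalence packs the forth and back conditions into one. \<open>Y\<close> ranges
  over subsets of \<open>worlds G\<close> because truth sets in \<open>G\<close> have that
  form.\<close>

definition bounded_morphism :: "('v \<Rightarrow> 'w) \<Rightarrow> 'v nframe \<Rightarrow> 'w nframe \<Rightarrow> bool" where
  "bounded_morphism f F G \<longleftrightarrow>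
     f ` worlds F \<subseteq> worlds G \<and>
     (\<forall>n. \<forall>w\<in>worlds F. \<forall>Y\<subseteq>worlds G.
        {v \<in> worlds F. f v \<in> Y} \<in> nbhd F n w \<longleftrightarrow> Y \<in> nbhd G n (f w))"

lemma bounded_morphism_nbhd_iff:
  assumes "bounded_morphism f F G" "w \<in> worlds F" "Y \<subseteq> worlds G"
  shows "{v \<in> worlds F. f v \<in> Y} \<in> nbhd F n w \<longleftrightarrow> Y \<in> nbhd G n (f w)"
  using assms by (simp add: bounded_morphism_def)

text \<open>Under the pulled-back valuation, the truth set of a formula in \<open>F\<close> is the
  preimage of its truth set in \<open>G\<close>; at a modality this is exactly the kind of set that
  \<open>bounded_morphism\<close> compares.\<close>

lemma sat_bounded_morphism:
  assumes "bounded_morphism f F G" "w \<in> worlds F"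
  shows "sat F (\<lambda>p. {v \<in> worlds F. f v \<in> V p}) w \<phi> \<longleftrightarrow> sat G V (f w) \<phi>"
  using assms(2)
proof (induction \<phi> arbitrary: w)
  case (Dia n \<phi>)
  let ?Y = "{u \<in> worlds G. sat G V u \<phi>}"
  have "{v \<in> worlds F. sat F (\<lambda>p. {v \<in> worlds F. f v \<in> V p}) v \<phi>} = {v \<in> worlds F. f v \<in> ?Y}"
    using Dia.IH assms(1) by (auto simp: bounded_morphism_def)
  moreover have "{v \<in> worlds F. f v \<in> ?Y} \<in> nbhd F n w \<longleftrightarrow> ?Y \<in> nbhd G n (f w)"
    by (rule bounded_morphism_nbhd_iff[OF assms(1) Dia.prems]) auto
  ultimately show ?case
    by simp
qed auto

text \<open>A valuation refuting the formula on \<open>G\<close> would pull back to one refuting it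
  on \<open>F\<close>, since by surjectivity the refuting point has a preimage.\<close>

lemma valid_bounded_morphic_image:
  fixes G :: "'w nframe" and \<phi> :: "'p fm"
  assumes "bounded_morphism f F G" "f ` worlds F = worlds G" "valid F \<phi>"
  shows "valid G \<phi>"
  unfolding valid_def
proof (intro allI impI ballI)
  fix V :: "'p \<Rightarrow> 'w set" and u
  assume "u \<in> worlds G"
  then obtain w where w: "w \<in> worlds F" "u = f w"
    using assms(2) by auto
  have "valuation F (\<lambda>p. {v \<in> worlds F. f v \<in> V p})"
    by (auto simp: valuation_def)
  then show "sat G V u \<phi>"
    using assms(3) w sat_bounded_morphism[OF assms(1) w(1)] unfolding valid_def by blast
qed

lemma Pow_ge_empty:
  assumes "finite A" "card A < n"
  shows "Pow_ge n A = {}"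
proof -
  have "finite X \<and> card X < n" if "X \<subseteq> A" for X
    using that assms finite_subset[of X A] card_mono[of A X] by linarith
  then show ?thesis
    by (auto simp: Pow_ge_def not_le)
qed

theorem proposition6p5:
  assumes "infinite (UNIV :: 'w set)"
  shows "\<not> (\<exists>\<Delta> :: 'p fm set.
            defines_class \<Delta> (graded_neighbourhood_frame :: 'w nframe \<Rightarrow> bool))"
proof
  assume "\<exists>\<Delta> :: 'p fm set. defines_class \<Delta> (graded_neighbourhood_frame :: 'w nframe \<Rightarrow> bool)"
  then obtain \<Delta> :: "'p fm set" where
    \<Delta>: "\<And>F :: 'w nframe. neighbourhood_frame F \<Longrightarrow> valid_set F \<Delta> \<longleftrightarrow> graded_neighbourhood_frame F"
    unfolding defines_class_def by blast
  obtain a b :: 'w where "a \<noteq> b"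
    using ex_new_if_finite[OF assms, of "{a}" for a] by blast
  define F :: "'w nframe" where
    "F = \<lparr>worlds = {a, b}, nbhd = \<lambda>n w. upset {a, b} (Pow_ge n {a, b})\<rparr>"
  \<comment> \<open>The neighbourhoods are forced by the constant map: the preimage of
    \<open>Y\<close> is all of \<open>worlds F\<close> or empty, according to whether
    \<open>a\<close> lies in \<open>Y\<close>. Reading them off at \<open>a\<close> is unambiguous,
    as both points of \<open>F\<close> have the same neighbourhoods.\<close>
  define G :: "'w nframe" where
    "G = \<lparr>worlds = {a}, nbhd = \<lambda>n w. {Y. Y \<subseteq> {a} \<and> {v \<in> worlds F. a \<in> Y} \<in> nbhd F n a}\<rparr>"
  have "neighbourhood_frame F" "graded_neighbourhood_frame F"
    by (auto simp: F_def graded_neighbourhood_frame_def neighbourhood_frame_def upset_def)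
  then have "valid_set F \<Delta>"
    using \<Delta> by blast
  moreover have "bounded_morphism (\<lambda>_. a) F G" "(\<lambda>_. a) ` worlds F = worlds G"
    by (auto simp: bounded_morphism_def F_def G_def)
  ultimately have "valid_set G \<Delta>"
    unfolding valid_set_def using valid_bounded_morphic_image[of _ F G] by metis
  moreover have "neighbourhood_frame G"
    by (auto simp: G_def neighbourhood_frame_def)
  ultimately have "graded_neighbourhood_frame G"
    using \<Delta> by blast
  then obtain A where A: "A \<subseteq> {a}" "\<And>n. nbhd G n a = upset {a} (Pow_ge n A)"
    by (auto simp: graded_neighbourhood_frame_def G_def)
  \<comment> \<open>The index 2 separates the frames: \<open>{a, b}\<close> reaches this size, and
    being the preimage of \<open>{a}\<close> it makes \<open>{a}\<close> a 2-neighbourhood in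
    \<open>G\<close>.\<close>
  have "{a, b} \<in> Pow_ge 2 {a, b}"
    using \<open>a \<noteq> b\<close> by (simp add: Pow_ge_def)
  then have "worlds F \<in> nbhd F 2 a"
    by (auto simp: F_def upset_def)
  then have "{a} \<in> nbhd G 2 a"
    by (simp add: G_def)
  \<comment> \<open>\<open>A\<close> has at most one element, so gradedness would leave
    \<open>a\<close> without any 2-neighbourhood in \<open>G\<close>.\<close>
  moreover have "Pow_ge 2 A = {}"
    using A(1) by (intro Pow_ge_empty) (auto simp: subset_singleton_iff)
  ultimately show False
    using A(2) by (simp add: upset_def)
qed

end
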